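(* Let $G$ be a connected graph of order $n$. Then $\gamma_{\rm sp}(G)=n-1$ if and only if $G\in\mathcal{F}$.
   Context: All graphs are finite, simple and undirected, with nonempty vertex set; the order of a graph is its number of vertices. For a vertex $v$ of $G$, $N(v)$ is the set of vertices adjacent to $v$, and for $D\subseteq V(G)$, $\overline{D}=V(G)\setminus D$. A set $D\subseteq V(G)$ is a super dominating set of $G$ if for every $u\in\overline{D}$ there exists $v\in D$ such that $N(v)\cap\overline{D}=\{u\}$. The super domination number $\gamma_{\rm sp}(G)$ is the minimum cardinality of a super dominating set of $G$. An empty graph is a graph without edges. The family $\mathcal{F}$ of graphs is defined as follows. Let $k$ and $k'$ be two positive integers such that $k'=k$ or $k'=k-1$. Let $\{G_i=(V_i,E_i): i=1,\dots,k\}$ be a family of complete graphs and let $\{G_i'=(V_i',E_i'): i=1,\dots,k'\}$ be a family of empty graphs; all the sets $V_1,\dots,V_k,V_1',\dots,V_{k'}'$ are nonempty and pairwise disjoint. Let $X_1=\bigcup_{i=1}^k E_i$ and $X_2=\{xy: x\in V_i,\ y\in V_j' \text{ and } 1\le i\le j\le k'\}$. For $k\ge 2$ let $X_3=\{xy: x\in V_i,\ y\in V_j \text{ and } 1\le i<j\le k\}$, and for $k=1$ let $X_3=\emptyset$. A graph $G$ belongs to $\mathcal{F}$ if, for some such $k,k'$ and some such families, $V(G)=\left(\bigcup_{i=1}^k V_i\right)\cup\left(\bigcup_{i=1}^{k'}V_i'\right)$ and $E(G)=X_1\cup X_2\cup X_3$ (membership is understood up to isomorphism). *)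

theory Defs
  imports "Graph_Theory.Digraph_Component" "HOL-Library.Disjoint_Sets"
begin

text \<open>Following the library, a finite simple undirected graph is a symmetric digraph without
  loops and parallel arcs (locale \<^locale>\<open>graph\<close>). Each undirected edge is a pair of opposite
  arcs.\<close>

definition edge_set :: "('a, 'b) pre_digraph \<Rightarrow> 'a set set" where
  "edge_set G = {{u, v} | u v. u \<rightarrow>\<^bsub>G\<^esub> v}"

definition nbhd :: "('a, 'b) pre_digraph \<Rightarrow> 'a \<Rightarrow> 'a set" where
  "nbhd G v = {u. v \<rightarrow>\<^bsub>G\<^esub> u}"

definition super_dominating :: "('a, 'b) pre_digraph \<Rightarrow> 'a set \<Rightarrow> bool" where
  "super_dominating G D \<longleftrightarrow> D \<subseteq> verts G \<and>
     (\<forall>u \<in> verts G - D. \<exists>v \<in> D. nbhd G v \<inter> (verts G - D) = {u})"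

definition super_domination_number :: "('a, 'b) pre_digraph \<Rightarrow> nat" where
  "super_domination_number G = (LEAST m. \<exists>D. super_dominating G D \<and> card D = m)"

definition complete_edges :: "'a set \<Rightarrow> 'a set set" where
  "complete_edges S = {{x, y} | x y. x \<in> S \<and> y \<in> S \<and> x \<noteq> y}"

text \<open>The complete graphs are given by their vertex sets \<open>V i\<close>, with edge sets
  \<open>complete_edges (V i)\<close>, and the empty graphs by their vertex sets \<open>V' i\<close>. These are subsets of
  the vertex type of \<open>G\<close> itself, so the family is closed under isomorphism. The third edge set
  below is empty for \<open>k = 1\<close>.\<close>

definition family_F :: "('a, 'b) pre_digraph set" where
  "family_F = {G. graph G \<and>
     (\<exists>(k :: nat) (k' :: nat) (V :: nat \<Rightarrow> 'a set) (V' :: nat \<Rightarrow> 'a set).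
        1 \<le> k \<and> 1 \<le> k' \<and> (k' = k \<or> k' = k - 1) \<and>
        (\<forall>i \<in> {1..k}. V i \<noteq> {}) \<and> (\<forall>j \<in> {1..k'}. V' j \<noteq> {}) \<and>
        disjoint_family_on V {1..k} \<and> disjoint_family_on V' {1..k'} \<and>
        (\<forall>i \<in> {1..k}. \<forall>j \<in> {1..k'}. V i \<inter> V' j = {}) \<and>
        verts G = (\<Union>i \<in> {1..k}. V i) \<union> (\<Union>j \<in> {1..k'}. V' j) \<and>
        edge_set G =
            (\<Union>i \<in> {1..k}. complete_edges (V i))
          \<union> {{x, y} | x y i j. x \<in> V i \<and> y \<in> V' j \<and> 1 \<le> i \<and> i \<le> j \<and> j \<le> k'}
          \<union> {{x, y} | x y i j. x \<in> V i \<and> y \<in> V j \<and> 1 \<le> i \<and> i < j \<and> j \<le> k})}"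

end

theory Submission
  imports Defs
begin

text \<open>Superdomination survives enlarging the dominating set: a witness for \<open>u\<close> remains one when
  other vertices leave the complement. So the super domination number drops below \<open>n - 1\<close> exactly
  when some two-element complement \<open>{b, d}\<close> works, which means that there are edges \<open>ab\<close> and
  \<open>cd\<close> with \<open>ad\<close> and \<open>cb\<close> non-edges: an alternating 4-cycle. As soon as there is an edge, the
  number is at most \<open>n - 1\<close>, so equality characterizes the graphs without alternating 4-cycles,
  known as threshold graphs (\<open>super_domination_number_eq_pred_iff_threshold\<close>).

  A member of the family is the same thing as a clique \<open>K\<close> and an independent set \<open>I\<close>, both
  divided into levels, in which \<open>x\<close> in \<open>K\<close> and \<open>y\<close> in \<open>I\<close> are adjacent exactly when the
  level of \<open>x\<close> is at most that of \<open>y\<close> (\<open>family_F_iff_level_split\<close>). Going round an alternating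
  4-cycle in such a graph gives a cyclic chain of inequalities between levels, two of them strict
  (\<open>level_split_imp_threshold\<close>).

  Conversely, a threshold graph splits into a clique and an independent set: comparing degrees
  decides which part a vertex belongs to (\<open>threshold_split\<close>). Two vertices of \<open>I\<close> with incomparable
  neighbourhoods would give an alternating 4-cycle, so the neighbourhoods of the vertices of \<open>I\<close>
  form a chain of subsets \<open>S\<^sub>1 \<subset> \<dots> \<subset> S\<^sub>m\<close>, with \<open>m = k'\<close>, of \<open>K\<close>. The level of
  \<open>y\<close> in \<open>I\<close> is the position of its neighbourhood in the chain, and the level of \<open>x\<close> in \<open>K\<close>
  is the position of the first member that contains \<open>x\<close>. Connectedness makes \<open>S\<^sub>1\<close> nonempty,
  so the lowest level of \<open>K\<close> is inhabited; the vertices of \<open>K\<close> outside \<open>S\<^sub>m\<close>, if any,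
  form one more level, and this accounts for the alternative \<open>k' = k - 1\<close>.\<close>

text \<open>The usual forbidden subgraphs \<open>2K\<^sub>2\<close>, \<open>P\<^sub>4\<close> and \<open>C\<^sub>4\<close> are covered at once, as
  nothing is said about the pairs \<open>ac\<close> and \<open>bd\<close>. The conditions \<open>a \<noteq> d\<close> and \<open>b \<noteq> c\<close> are
  there because a vertex is never adjacent to itself.\<close>

definition threshold :: "('a, 'b) pre_digraph \<Rightarrow> bool" where
  "threshold G \<longleftrightarrow>
     \<not> (\<exists>a b c d. a \<rightarrow>\<^bsub>G\<^esub> b \<and> c \<rightarrow>\<^bsub>G\<^esub> d \<and> a \<noteq> d \<and> b \<noteq> c \<and> \<not> a \<rightarrow>\<^bsub>G\<^esub> d \<and> \<not> c \<rightarrow>\<^bsub>G\<^esub> b)"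

text \<open>The values of \<open>f\<close> and \<open>g\<close> are the indices of the blocks \<open>V i\<close> and \<open>V' j\<close> of the family.
  Functions in place of indexed set families turn block adjacency into an inequality.\<close>

definition level_split ::
  "('a, 'b) pre_digraph \<Rightarrow> 'a set \<Rightarrow> 'a set \<Rightarrow> ('a \<Rightarrow> nat) \<Rightarrow> ('a \<Rightarrow> nat) \<Rightarrow> bool" where
  "level_split G K I f g \<longleftrightarrow>
     verts G = K \<union> I \<and> K \<inter> I = {} \<and>
     (\<forall>x\<in>K. \<forall>y\<in>K. x \<rightarrow>\<^bsub>G\<^esub> y \<longleftrightarrow> x \<noteq> y) \<and> (\<forall>x\<in>I. \<forall>y\<in>I. \<not> x \<rightarrow>\<^bsub>G\<^esub> y) \<and>
     (\<forall>x\<in>K. \<forall>y\<in>I. x \<rightarrow>\<^bsub>G\<^esub> y \<longleftrightarrow> f x \<le> g y)"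

lemma level_splitD:
  assumes "level_split G K I f g"
  shows "verts G = K \<union> I" "K \<inter> I = {}"
    "x \<in> K \<Longrightarrow> y \<in> K \<Longrightarrow> x \<rightarrow>\<^bsub>G\<^esub> y \<longleftrightarrow> x \<noteq> y"
    "x \<in> I \<Longrightarrow> y \<in> I \<Longrightarrow> \<not> x \<rightarrow>\<^bsub>G\<^esub> y"
    "x \<in> K \<Longrightarrow> y \<in> I \<Longrightarrow> x \<rightarrow>\<^bsub>G\<^esub> y \<longleftrightarrow> f x \<le> g y"
  using assms by (simp_all add: level_split_def)

section \<open>Super domination and forbidden alternating 4-cycles\<close>

lemma (in graph) dominates_sym: "u \<rightarrow>\<^bsub>G\<^esub> v \<longleftrightarrow> v \<rightarrow>\<^bsub>G\<^esub> u"
  using arcs_ends_symmetric[OF sym_arcs] by blast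

lemma (in graph) super_domination_number_le:
  assumes "super_dominating G D"
  shows "super_domination_number G \<le> card D"
  unfolding super_domination_number_def using assms by (intro Least_le) blast

lemma (in graph) super_domination_number_attained:
  obtains D where "super_dominating G D" "card D = super_domination_number G"
proof -
  have "super_dominating G (verts G)"
    by (simp add: super_dominating_def)
  then have "\<exists>D. super_dominating G D \<and> card D = super_domination_number G"
    unfolding super_domination_number_def
    by (intro LeastI_ex[where P = "\<lambda>m. \<exists>D. super_dominating G D \<and> card D = m"]) blast
  then show thesis
    using that by blast
qed

text \<open>The edge is what makes \<open>n - 1\<close> an upper bound: one of its ends dominates the other, which can
  be left out. Leaving out two vertices \<open>b\<close> and \<open>d\<close> takes witnesses \<open>a\<close> and \<open>c\<close> that see one
  of them each, and \<open>a\<close>, \<open>b\<close>, \<open>c\<close>, \<open>d\<close> then form an alternating 4-cycle.\<close>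

lemma (in graph) super_domination_number_eq_pred_iff_threshold:
  assumes edge: "p \<rightarrow>\<^bsub>G\<^esub> q"
  shows "super_domination_number G = card (verts G) - 1 \<longleftrightarrow> threshold G"
proof
  assume eq: "super_domination_number G = card (verts G) - 1"
  show "threshold G"
    unfolding threshold_def
  proof (rule notI, elim exE conjE)
    fix a b c d
    assume ab: "a \<rightarrow>\<^bsub>G\<^esub> b" and cd: "c \<rightarrow>\<^bsub>G\<^esub> d" and "a \<noteq> d" "b \<noteq> c" and nad: "\<not> a \<rightarrow>\<^bsub>G\<^esub> d" and ncb: "\<not> c \<rightarrow>\<^bsub>G\<^esub> b"
    have V: "{a, b, c, d} \<subseteq> verts G"
      using ab cd by (auto dest: adj_in_verts)
    have "b \<noteq> d" "a \<noteq> b" "c \<noteq> d"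
      using ab cd nad by (auto dest: adj_not_same)
    have compl: "verts G - (verts G - {b, d}) = {b, d}"
      using V by auto
    have "nbhd G a \<inter> {b, d} = {b}" "nbhd G c \<inter> {b, d} = {d}"
      using ab cd nad ncb by (auto simp: nbhd_def)
    then have "super_dominating G (verts G - {b, d})"
      unfolding super_dominating_def compl
      using V \<open>a \<noteq> d\<close> \<open>b \<noteq> c\<close> \<open>a \<noteq> b\<close> \<open>c \<noteq> d\<close> by auto
    then have "super_domination_number G \<le> card (verts G) - 2"
      using super_domination_number_le[of "verts G - {b, d}"] V \<open>b \<noteq> d\<close>
      by (simp add: card_Diff_subset)
    moreover have "card {b, d} \<le> card (verts G)"
      using V by (intro card_mono) auto
    \<comment> \<open>At least two vertices are needed here, since subtraction is truncated.\<close>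
    ultimately show False
      using eq \<open>b \<noteq> d\<close> by simp
  qed
next
  assume thr: "threshold G"
  have pq: "p \<in> verts G" "q \<in> verts G" "p \<noteq> q"
    using edge by (auto dest: adj_in_verts adj_not_same)
  then have "verts G - (verts G - {q}) = {q}"
    by auto
  then have "super_dominating G (verts G - {q})"
    unfolding super_dominating_def nbhd_def using pq edge by auto
  then have upper: "super_domination_number G \<le> card (verts G) - 1"
    using super_domination_number_le[of "verts G - {q}"] pq by simp
  obtain D where D: "super_dominating G D" "card D = super_domination_number G"
    by (rule super_domination_number_attained)
  have sub: "D \<subseteq> verts G"
    using D(1) by (simp add: super_dominating_def)
  have "b = d" if b: "b \<in> verts G - D" and d: "d \<in> verts G - D" for b d
  proof (rule ccontr)
    assume "b \<noteq> d"
    obtain a where a: "a \<in> D" "nbhd G a \<inter> (verts G - D) = {b}"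
      using D(1) b unfolding super_dominating_def by meson
    obtain c where c: "c \<in> D" "nbhd G c \<inter> (verts G - D) = {d}"
      using D(1) d unfolding super_dominating_def by meson
    have "b \<in> nbhd G a" "d \<notin> nbhd G a" "d \<in> nbhd G c" "b \<notin> nbhd G c"
      using a(2) c(2) b d \<open>b \<noteq> d\<close> by (auto simp: set_eq_iff)
    then have "a \<rightarrow>\<^bsub>G\<^esub> b" "c \<rightarrow>\<^bsub>G\<^esub> d" "\<not> a \<rightarrow>\<^bsub>G\<^esub> d" "\<not> c \<rightarrow>\<^bsub>G\<^esub> b"
      by (simp_all add: nbhd_def)
    moreover have "a \<noteq> d" "b \<noteq> c"
      using a(1) c(1) b d by auto
    ultimately show False
      using thr unfolding threshold_def by blast
  qed
  then have "card (verts G - D) \<le> 1"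
    by (subst One_nat_def, subst card_le_Suc0_iff_eq) auto
  then have "card (verts G) - 1 \<le> card D"
    using sub by (simp add: card_Diff_subset finite_subset)
  then show "super_domination_number G = card (verts G) - 1"
    using upper D(2) by simp
qed

section \<open>The family as graphs with levels\<close>

text \<open>The edges within the blocks \<open>V i\<close> and those between different blocks together make the union
  of these blocks a clique; the remaining edges compare levels.\<close>

lemma complete_edges_Un_level_edges:
  fixes f g :: "'a \<Rightarrow> nat"
  assumes V: "\<And>i. i \<in> {1..k} \<Longrightarrow> V i = {x \<in> K. f x = i}"
    and V': "\<And>j. j \<in> {1..k'} \<Longrightarrow> V' j = {y \<in> I. g y = j}"
    and f: "f ` K = {1..k}" and g: "g ` I = {1..k'}" and "k' \<le> k"
  shows "(\<Union>i \<in> {1..k}. complete_edges (V i))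
          \<union> {{x, y} | x y i j. x \<in> V i \<and> y \<in> V' j \<and> 1 \<le> i \<and> i \<le> j \<and> j \<le> k'}
          \<union> {{x, y} | x y i j. x \<in> V i \<and> y \<in> V j \<and> 1 \<le> i \<and> i < j \<and> j \<le> k}
        = complete_edges K \<union> {{x, y} | x y. x \<in> K \<and> y \<in> I \<and> f x \<le> g y}"
    (is "?A \<union> ?B \<union> ?C = _ \<union> ?D")
proof -
  have fK: "1 \<le> f x" "f x \<le> k" if "x \<in> K" for x
    using f that by auto
  have gI: "1 \<le> g y" "g y \<le> k'" if "y \<in> I" for y
    using g that by auto
  have Vf: "x \<in> V (f x)" if "x \<in> K" for x
    using V[of "f x"] fK[OF that] that by auto
  have Vg: "y \<in> V' (g y)" if "y \<in> I" for y
    using V'[of "g y"] gI[OF that] that by auto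
  have VD: "x \<in> K \<and> f x = i" if "x \<in> V i" "1 \<le> i" "i \<le> k" for x i
    using V[of i] that by auto
  have VD': "y \<in> I \<and> g y = j" if "y \<in> V' j" "1 \<le> j" "j \<le> k'" for y j
    using V'[of j] that by auto
  have A: "?A \<subseteq> complete_edges K"
    unfolding complete_edges_def using VD by fastforce
  have C: "?C \<subseteq> complete_edges K"
  proof
    fix e assume "e \<in> ?C"
    then obtain x y i j where e: "e = {x, y}" "x \<in> V i" "y \<in> V j" "1 \<le> i" "i < j" "j \<le> k"
      by blast
    then have "x \<in> K \<and> f x = i" "y \<in> K \<and> f y = j"
      using VD by auto
    then show "e \<in> complete_edges K"
      unfolding complete_edges_def using e by auto
  qed
  have K: "complete_edges K \<subseteq> ?A \<union> ?C"
  proof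
    fix e assume "e \<in> complete_edges K"
    then obtain x y where e: "e = {x, y}" "x \<in> K" "y \<in> K" "x \<noteq> y"
      unfolding complete_edges_def by blast
    note m = Vf[OF e(2)] Vf[OF e(3)] fK[OF e(2)] fK[OF e(3)]
    consider "f x = f y" | "f x < f y" | "f y < f x"
      by linarith
    then show "e \<in> ?A \<union> ?C"
    proof cases
      case 1
      then have "e \<in> complete_edges (V (f x))"
        unfolding complete_edges_def using e m by auto
      then show ?thesis
        using m by auto
    next
      case 2
      then have "e \<in> ?C"
        using e(1) m by blast
      then show ?thesis
        by blast
    next
      case 3
      have "e = {y, x}"
        using e(1) by auto
      with 3 have "e \<in> ?C"
        using m by blast
      then show ?thesis
        by blast
    qed
  qed
  have B: "?B \<subseteq> ?D"
  proof
    fix e assume "e \<in> ?B"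
    then obtain x y i j where e: "e = {x, y}" "x \<in> V i" "y \<in> V' j" "1 \<le> i" "i \<le> j" "j \<le> k'"
      by blast
    then have "x \<in> K \<and> f x = i" "y \<in> I \<and> g y = j"
      using VD VD' \<open>k' \<le> k\<close> by auto
    then show "e \<in> ?D"
      using e by blast
  qed
  have D: "?D \<subseteq> ?B"
  proof
    fix e assume "e \<in> ?D"
    then obtain x y where e: "e = {x, y}" "x \<in> K" "y \<in> I" "f x \<le> g y"
      by blast
    have "x \<in> V (f x) \<and> y \<in> V' (g y) \<and> 1 \<le> f x \<and> f x \<le> g y \<and> g y \<le> k'"
      using Vf Vg fK gI e by simp
    then show "e \<in> ?B"
      using e(1) by (intro CollectI exI conjI) auto
  qed
  have BD: "?B = ?D"
    by (rule subset_antisym[OF B D])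
  have AC: "?A \<union> ?C = complete_edges K"
    by (rule subset_antisym[OF Un_least[OF A C] K])
  have "?A \<union> ?B \<union> ?C = (?A \<union> ?C) \<union> ?B"
    by (simp only: Un_ac)
  then show ?thesis
    by (simp only: BD AC)
qed

lemma (in graph) edge_set_doubleton: "{u, v} \<in> edge_set G \<longleftrightarrow> u \<rightarrow>\<^bsub>G\<^esub> v"
  unfolding edge_set_def using dominates_sym by (auto simp: doubleton_eq_iff)

lemma (in graph) level_split_iff_edge_set:
  assumes "verts G = K \<union> I" "K \<inter> I = {}"
  shows "level_split G K I f g \<longleftrightarrow>
    edge_set G = complete_edges K \<union> {{x, y} | x y. x \<in> K \<and> y \<in> I \<and> f x \<le> g y}" (is "_ \<longleftrightarrow> _ = ?E")
proof
  assume L: "level_split G K I f g"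
  show "edge_set G = ?E"
  proof
    show "edge_set G \<subseteq> ?E"
    proof
      fix e assume "e \<in> edge_set G"
      then obtain u v where e: "e = {u, v}" and uv: "u \<rightarrow>\<^bsub>G\<^esub> v"
        unfolding edge_set_def by blast
      have vu: "v \<rightarrow>\<^bsub>G\<^esub> u" and e': "e = {v, u}"
        using uv dominates_sym e by auto
      have "u \<in> K \<union> I" "v \<in> K \<union> I"
        using adj_in_verts[OF uv] assms(1) by auto
      then consider "u \<in> K" "v \<in> K" | "u \<in> K" "v \<in> I" | "u \<in> I" "v \<in> K" | "u \<in> I" "v \<in> I"
        by blast
      then show "e \<in> ?E"
      proof cases
        case 1
        then have "u \<noteq> v" using uv level_splitD[OF L] by simp
        then show ?thesis using 1 e unfolding complete_edges_def by blast
      next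
        case 2
        then have "f u \<le> g v" using uv level_splitD[OF L] by simp
        then show ?thesis using 2 e by blast
      next
        case 3
        then have "f v \<le> g u" using vu level_splitD[OF L] by simp
        then show ?thesis using 3 e' by blast
      next
        case 4
        then show ?thesis using uv level_splitD[OF L] by simp
      qed
    qed
    show "?E \<subseteq> edge_set G"
    proof
      fix e assume "e \<in> ?E"
      then consider x y where "e = {x, y}" "x \<in> K" "y \<in> K" "x \<noteq> y"
        | x y where "e = {x, y}" "x \<in> K" "y \<in> I" "f x \<le> g y"
        unfolding complete_edges_def by blast
      then obtain x y where "e = {x, y}" "x \<rightarrow>\<^bsub>G\<^esub> y"
        by cases (auto simp: level_splitD[OF L])
      then show "e \<in> edge_set G"
        by (simp add: edge_set_doubleton)
    qed
  qed
next
  assume "edge_set G = ?E"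
  then have *: "u \<rightarrow>\<^bsub>G\<^esub> v \<longleftrightarrow> {u, v} \<in> ?E" for u v
    using edge_set_doubleton by metis
  have adj: "u \<rightarrow>\<^bsub>G\<^esub> v \<longleftrightarrow> u \<in> K \<and> v \<in> K \<and> u \<noteq> v \<or>
      u \<in> K \<and> v \<in> I \<and> f u \<le> g v \<or> v \<in> K \<and> u \<in> I \<and> f v \<le> g u" for u v
    unfolding * complete_edges_def Un_iff mem_Collect_eq doubleton_eq_iff
    by (rule iffI, (elim disjE exE conjE; simp), (elim disjE conjE; blast))
  have K_I: "x \<notin> I" if "x \<in> K" for x
    using assms(2) that by blast
  show "level_split G K I f g"
    unfolding level_split_def
  proof (intro conjI ballI)
    fix x y
    show "x \<rightarrow>\<^bsub>G\<^esub> y \<longleftrightarrow> x \<noteq> y" if "x \<in> K" "y \<in> K"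
      unfolding adj using that K_I by blast
    show "\<not> x \<rightarrow>\<^bsub>G\<^esub> y" if "x \<in> I" "y \<in> I"
      unfolding adj using that K_I by blast
    show "x \<rightarrow>\<^bsub>G\<^esub> y \<longleftrightarrow> f x \<le> g y" if "x \<in> K" "y \<in> I"
      unfolding adj using that K_I by blast
  qed (use assms in auto)
qed

text \<open>Surjectivity of the level functions onto initial segments expresses that all blocks are
  nonempty; disjointness of the blocks is implicit in their being fibres of a function.\<close>

lemma (in graph) family_F_iff_level_split:
  "G \<in> family_F \<longleftrightarrow>
    (\<exists>K I f g k k'. level_split G K I f g \<and> 1 \<le> k' \<and> (k' = k \<or> k' = k - 1) \<and>
       f ` K = {1..k} \<and> g ` I = {1..k'})" (is "_ \<longleftrightarrow> ?R")
proof
  assume "G \<in> family_F"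
  then obtain k k' :: nat and V V' :: "nat \<Rightarrow> 'a set" where k: "1 \<le> k" "1 \<le> k'" "k' = k \<or> k' = k - 1"
    and ne: "\<forall>i \<in> {1..k}. V i \<noteq> {}" "\<forall>j \<in> {1..k'}. V' j \<noteq> {}"
    and disj: "disjoint_family_on V {1..k}" "disjoint_family_on V' {1..k'}"
      "\<forall>i \<in> {1..k}. \<forall>j \<in> {1..k'}. V i \<inter> V' j = {}"
    and verts: "verts G = (\<Union>i \<in> {1..k}. V i) \<union> (\<Union>j \<in> {1..k'}. V' j)"
    and edges: "edge_set G = (\<Union>i \<in> {1..k}. complete_edges (V i))
          \<union> {{x, y} | x y i j. x \<in> V i \<and> y \<in> V' j \<and> 1 \<le> i \<and> i \<le> j \<and> j \<le> k'}
          \<union> {{x, y} | x y i j. x \<in> V i \<and> y \<in> V j \<and> 1 \<le> i \<and> i < j \<and> j \<le> k}"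
    unfolding family_F_def by (elim CollectE conjE exE) (rule that)
  define K where "K = (\<Union>i \<in> {1..k}. V i)"
  define I where "I = (\<Union>j \<in> {1..k'}. V' j)"
  define f where "f x = (THE i. i \<in> {1..k} \<and> x \<in> V i)" for x
  define g where "g y = (THE j. j \<in> {1..k'} \<and> y \<in> V' j)" for y
  have f_eq: "f x = i" if "x \<in> V i" "i \<in> {1..k}" for x i
    unfolding f_def using that disjoint_family_onD[OF disj(1)] by (intro the_equality) blast+
  have g_eq: "g y = j" if "y \<in> V' j" "j \<in> {1..k'}" for y j
    unfolding g_def using that disjoint_family_onD[OF disj(2)] by (intro the_equality) blast+
  have V: "V i = {x \<in> K. f x = i}" if "i \<in> {1..k}" for i
    unfolding K_def using that f_eq by blast
  have V': "V' j = {y \<in> I. g y = j}" if "j \<in> {1..k'}" for j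
    unfolding I_def using that g_eq by blast
  have fK: "f ` K = {1..k}"
  proof
    show "f ` K \<subseteq> {1..k}" unfolding K_def using f_eq by blast
    show "{1..k} \<subseteq> f ` K" using ne(1) V by fastforce
  qed
  have gI: "g ` I = {1..k'}"
  proof
    show "g ` I \<subseteq> {1..k'}" unfolding I_def using g_eq by blast
    show "{1..k'} \<subseteq> g ` I" using ne(2) V' by fastforce
  qed
  have "k' \<le> k" using k by auto
  have "verts G = K \<union> I" "K \<inter> I = {}"
    using verts disj(3) unfolding K_def I_def by auto
  then have "level_split G K I f g"
    using trans[OF edges complete_edges_Un_level_edges[OF V V' fK gI \<open>k' \<le> k\<close>]]
    by (rule level_split_iff_edge_set[THEN iffD2])
  then have "level_split G K I f g \<and> 1 \<le> k' \<and> (k' = k \<or> k' = k - 1) \<and>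
      f ` K = {1..k} \<and> g ` I = {1..k'}"
    using k(2,3) fK gI by (intro conjI)
  then show ?R
    by (intro exI)
next
  assume ?R
  then obtain K I f g k k' where L: "level_split G K I f g" and k: "1 \<le> k'" "k' = k \<or> k' = k - 1"
    and fK: "f ` K = {1..k}" and gI: "g ` I = {1..k'}"
    by (elim exE conjE)
  define V where "V i = {x \<in> K. f x = i}" for i
  define V' where "V' j = {y \<in> I. g y = j}" for j
  have "k' \<le> k" "1 \<le> k" using k by auto
  have vs: "verts G = K \<union> I" "K \<inter> I = {}"
    using L by (auto simp: level_split_def)
  have E: "edge_set G = (\<Union>i \<in> {1..k}. complete_edges (V i))
          \<union> {{x, y} | x y i j. x \<in> V i \<and> y \<in> V' j \<and> 1 \<le> i \<and> i \<le> j \<and> j \<le> k'}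
          \<union> {{x, y} | x y i j. x \<in> V i \<and> y \<in> V j \<and> 1 \<le> i \<and> i < j \<and> j \<le> k}"
    using complete_edges_Un_level_edges[OF V_def V'_def fK gI \<open>k' \<le> k\<close>] L
      level_split_iff_edge_set[OF vs] by simp
  have K: "(\<Union>i \<in> {1..k}. V i) = K"
    using fK unfolding V_def by blast
  have I: "(\<Union>j \<in> {1..k'}. V' j) = I"
    using gI unfolding V'_def by blast
  have V_ne: "\<forall>i \<in> {1..k}. V i \<noteq> {}"
    unfolding V_def fK[symmetric] by blast
  have V'_ne: "\<forall>j \<in> {1..k'}. V' j \<noteq> {}"
    unfolding V'_def gI[symmetric] by blast
  have disj: "disjoint_family_on V {1..k}" "disjoint_family_on V' {1..k'}"
    "\<forall>i \<in> {1..k}. \<forall>j \<in> {1..k'}. V i \<inter> V' j = {}"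
    using vs(2) unfolding V_def V'_def disjoint_family_on_def by blast+
  have "verts G = (\<Union>i \<in> {1..k}. V i) \<union> (\<Union>j \<in> {1..k'}. V' j)"
    unfolding K I by (rule vs(1))
  then show "G \<in> family_F"
    unfolding family_F_def
    using \<open>1 \<le> k\<close> k V_ne V'_ne disj E graph_axioms
    by (intro CollectI conjI exI[of _ k] exI[of _ k'] exI[of _ V] exI[of _ V'])
qed

text \<open>Of two distinct nonadjacent vertices at least one lies in \<open>I\<close>, of the ends of an edge at least
  one lies in \<open>K\<close>. Hence the vertices of an alternating 4-cycle lie alternately in \<open>I\<close> and \<open>K\<close>, and the
  levels along it would have to increase for ever.\<close>

lemma (in graph) level_split_imp_threshold:
  assumes L: "level_split G K I f g"
  shows "threshold G"
  unfolding threshold_def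
proof (rule notI, elim exE conjE)
  fix a b c d
  assume ab: "a \<rightarrow>\<^bsub>G\<^esub> b" and cd: "c \<rightarrow>\<^bsub>G\<^esub> d" and ne: "a \<noteq> d" "b \<noteq> c" and nad: "\<not> a \<rightarrow>\<^bsub>G\<^esub> d" and ncb: "\<not> c \<rightarrow>\<^bsub>G\<^esub> b"
  have V: "a \<in> K \<union> I" "b \<in> K \<union> I" "c \<in> K \<union> I" "d \<in> K \<union> I"
    using adj_in_verts[OF ab] adj_in_verts[OF cd] level_splitD(1)[OF L] by simp_all
  have clique: "x \<rightarrow>\<^bsub>G\<^esub> y" if "x \<in> K" "y \<in> K" "x \<noteq> y" for x y
    using that level_splitD[OF L] by simp
  have indep: "\<not> x \<rightarrow>\<^bsub>G\<^esub> y" if "x \<in> I" "y \<in> I" for x y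
    using that level_splitD[OF L] by simp
  have lev: "x \<rightarrow>\<^bsub>G\<^esub> y \<longleftrightarrow> f x \<le> g y" "y \<rightarrow>\<^bsub>G\<^esub> x \<longleftrightarrow> f x \<le> g y" if "x \<in> K" "y \<in> I" for x y
    using that level_splitD(5)[OF L] dominates_sym by auto
  have "a \<in> I \<or> d \<in> I"
    using V clique ne nad by blast
  then show False
  proof
    assume "a \<in> I"
    then have "b \<in> K" using indep ab V by blast
    then have "c \<in> I" using clique ncb V ne by blast
    then have "d \<in> K" using indep cd V by blast
    have "f b \<le> g a" "g a < f d" "f d \<le> g c" "g c < f b"
      using lev \<open>a \<in> I\<close> \<open>b \<in> K\<close> \<open>c \<in> I\<close> \<open>d \<in> K\<close> ab cd nad ncb by (auto simp: not_le[symmetric])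
    then show False by linarith
  next
    assume "d \<in> I"
    then have "c \<in> K" using indep cd V by blast
    then have "b \<in> I" using clique ncb V ne by blast
    then have "a \<in> K" using indep ab V by blast
    have "f a \<le> g b" "g b < f c" "f c \<le> g d" "g d < f a"
      using lev \<open>a \<in> K\<close> \<open>b \<in> I\<close> \<open>c \<in> K\<close> \<open>d \<in> I\<close> ab cd nad ncb by (auto simp: not_le[symmetric])
    then show False by linarith
  qed
qed

section \<open>Threshold graphs are split graphs\<close>

lemma (in graph) finite_nbhd: "finite (nbhd G v)"
  by (rule finite_subset[OF _ finite_verts]) (auto simp: nbhd_def dest: adj_in_verts)

text \<open>A vertex is put into \<open>K\<close> when it is adjacent to all other vertices of at least its degree. Of two
  vertices in \<open>K\<close> one has the smaller or equal degree, so they are adjacent. If two vertices \<open>v\<close>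
  and \<open>v'\<close> of \<open>I\<close> were adjacent, the one of larger degree, \<open>v\<close>, would miss some \<open>w\<close> of at
  least that degree. As \<open>v'\<close> has the neighbour \<open>v\<close> that \<open>w\<close> lacks, \<open>w\<close> has a neighbour
  \<open>z\<close> that \<open>v'\<close> lacks, and the edges \<open>v'v\<close> and \<open>wz\<close> yield an alternating 4-cycle.\<close>

lemma (in graph) threshold_split:
  assumes thr: "threshold G" and "verts G \<noteq> {}"
  obtains K I where "verts G = K \<union> I" "K \<inter> I = {}" "I \<noteq> {}"
    "\<And>x y. x \<in> K \<Longrightarrow> y \<in> K \<Longrightarrow> x \<noteq> y \<Longrightarrow> x \<rightarrow>\<^bsub>G\<^esub> y" "\<And>x y. x \<in> I \<Longrightarrow> y \<in> I \<Longrightarrow> \<not> x \<rightarrow>\<^bsub>G\<^esub> y"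
proof -
  define deg where "deg v = card (nbhd G v)" for v
  define K where "K = {v \<in> verts G. \<forall>w \<in> verts G. w \<noteq> v \<longrightarrow> deg v \<le> deg w \<longrightarrow> v \<rightarrow>\<^bsub>G\<^esub> w}"
  define I where "I = verts G - K"
  have clique: "x \<rightarrow>\<^bsub>G\<^esub> y" if "x \<in> K" "y \<in> K" "x \<noteq> y" for x y
  proof (cases "deg x \<le> deg y")
    case True
    then show ?thesis using that unfolding K_def by auto
  next
    case False
    then have "y \<rightarrow>\<^bsub>G\<^esub> x" using that unfolding K_def by auto
    then show ?thesis using dominates_sym by blast
  qed
  have no_edge: False
    if v: "v \<in> I" and vv': "v \<rightarrow>\<^bsub>G\<^esub> v'" and deg: "deg v' \<le> deg v" for v v'
  proof -
    obtain w where w: "w \<noteq> v" "deg v \<le> deg w" "\<not> v \<rightarrow>\<^bsub>G\<^esub> w"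
      using v unfolding I_def K_def by blast
    have "w \<noteq> v'" using vv' w by auto
    \<comment> \<open>The edge between \<open>v'\<close> and \<open>w\<close>, if present, is removed from both neighbourhoods, so that
      comparing their sizes still compares the degrees.\<close>
    have "\<not> nbhd G w - {v'} \<subseteq> nbhd G v' - {w}"
    proof
      assume "nbhd G w - {v'} \<subseteq> nbhd G v' - {w}"
      moreover have "v \<in> nbhd G v' - {w}" "v \<notin> nbhd G w - {v'}"
        using vv' w dominates_sym by (auto simp: nbhd_def)
      ultimately have "nbhd G w - {v'} \<subset> nbhd G v' - {w}"
        by blast
      then have "card (nbhd G w - {v'}) < card (nbhd G v' - {w})"
        by (intro psubset_card_mono) (auto simp: finite_nbhd)
      moreover have "v' \<in> nbhd G w \<longleftrightarrow> w \<in> nbhd G v'"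
        using dominates_sym by (auto simp: nbhd_def)
      ultimately have "deg w < deg v'"
        unfolding deg_def using finite_nbhd
        by (cases "w \<in> nbhd G v'") (auto simp: card_Diff_singleton_if)
      then show False using deg w by simp
    qed
    then obtain z where "w \<rightarrow>\<^bsub>G\<^esub> z" "z \<noteq> v'" "\<not> v' \<rightarrow>\<^bsub>G\<^esub> z"
      using adj_not_same by (auto simp: nbhd_def)
    moreover have "v' \<rightarrow>\<^bsub>G\<^esub> v" "\<not> w \<rightarrow>\<^bsub>G\<^esub> v"
      using vv' w dominates_sym by auto
    ultimately show False
      using thr w unfolding threshold_def by blast
  qed
  have indep: "\<not> x \<rightarrow>\<^bsub>G\<^esub> y" if "x \<in> I" "y \<in> I" for x y
    using no_edge[of x y] no_edge[of y x] that dominates_sym by (meson nle_le)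
  show thesis
  proof (cases "I = {}")
    case False
    then show thesis
      using that[of K I] clique indep unfolding I_def K_def by blast
  next
    case True
    \<comment> \<open>The graph is complete, and any single vertex can serve as the independent part.\<close>
    obtain a where "a \<in> verts G" using assms(2) by blast
    moreover have "verts G = K" using True unfolding I_def K_def by blast
    ultimately show thesis
      using that[of "K - {a}" "{a}"] clique adj_not_same by blast
  qed
qed

section \<open>Levels from a chain of neighbourhoods\<close>

definition rank_in :: "'a set set \<Rightarrow> 'a set \<Rightarrow> nat" where
  "rank_in C S = card {T \<in> C. T \<subseteq> S}"

text \<open>On a finite chain the rank is strictly monotone, hence injective, and its values lie among the
  \<open>card C\<close> possible positions. So it takes each of them.\<close>

lemma rank_in_chain_image:
  assumes "finite C" and chain: "\<And>S T. S \<in> C \<Longrightarrow> T \<in> C \<Longrightarrow> S \<subseteq> T \<or> T \<subseteq> S"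
  shows "rank_in C ` C = {1..card C}"
proof (rule card_subset_eq)
  show "rank_in C ` C \<subseteq> {1..card C}"
  proof
    fix i assume "i \<in> rank_in C ` C"
    then obtain S where S: "S \<in> C" "i = rank_in C S" by blast
    have "card {S} \<le> card {T \<in> C. T \<subseteq> S}"
      using S \<open>finite C\<close> by (intro card_mono) auto
    moreover have "card {T \<in> C. T \<subseteq> S} \<le> card C"
      using \<open>finite C\<close> by (intro card_mono) auto
    ultimately show "i \<in> {1..card C}" using S by (simp add: rank_in_def)
  qed
  have less: "rank_in C S < rank_in C T" if "S \<in> C" "T \<in> C" "S \<subset> T" for S T
    unfolding rank_in_def using \<open>finite C\<close> that by (intro psubset_card_mono) auto
  have "inj_on (rank_in C) C"
  proof (rule inj_onI)
    fix S T assume "S \<in> C" "T \<in> C" "rank_in C S = rank_in C T"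
    then show "S = T" using chain[of S T] less[of S T] less[of T S] by auto
  qed
  then show "card (rank_in C ` C) = card {1..card C}"
    by (simp add: card_image)
qed simp

text \<open>In a chain, the members avoiding \<open>x\<close> form an initial segment, as do those contained in \<open>S\<close>.
  This equivalence turns adjacency between clique and independent set into an inequality of
  levels.\<close>

lemma mem_iff_card_less_rank_in:
  assumes "finite C" and chain: "\<And>S T. S \<in> C \<Longrightarrow> T \<in> C \<Longrightarrow> S \<subseteq> T \<or> T \<subseteq> S" and "S \<in> C"
  shows "x \<in> S \<longleftrightarrow> card {T \<in> C. x \<notin> T} < rank_in C S"
proof
  assume "x \<in> S"
  then have "{T \<in> C. x \<notin> T} \<subset> {T \<in> C. T \<subseteq> S}"
    using chain \<open>S \<in> C\<close> by blast
  then show "card {T \<in> C. x \<notin> T} < rank_in C S"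
    unfolding rank_in_def using \<open>finite C\<close> by (intro psubset_card_mono) auto
next
  assume less: "card {T \<in> C. x \<notin> T} < rank_in C S"
  show "x \<in> S"
  proof (rule ccontr)
    assume "x \<notin> S"
    then have "rank_in C S \<le> card {T \<in> C. x \<notin> T}"
      unfolding rank_in_def using \<open>finite C\<close> by (intro card_mono) auto
    then show False using less by simp
  qed
qed

text \<open>The union of the predecessors of \<open>S\<close> in a finite chain is itself one of them, or empty, so it
  does not exhaust \<open>S\<close>. A vertex of \<open>S\<close> outside this union belongs to the level of \<open>S\<close>; this
  shows that each of the first \<open>card C\<close> levels of the clique is inhabited.\<close>

lemma chain_level_attained:
  assumes fin: "finite C" and chain: "\<And>S T. S \<in> C \<Longrightarrow> T \<in> C \<Longrightarrow> S \<subseteq> T \<or> T \<subseteq> S"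
    and ne: "{} \<notin> C" and "S \<in> C"
  obtains x where "x \<in> S" "card {T \<in> C. x \<notin> T} + 1 = rank_in C S"
proof -
  have "\<exists>x \<in> S. \<forall>T \<in> C. T \<subset> S \<longrightarrow> x \<notin> T"
  proof (cases "{T \<in> C. T \<subset> S} = {}")
    case True
    then show ?thesis using ne \<open>S \<in> C\<close> by fastforce
  next
    case False
    have "\<Union> {T \<in> C. T \<subset> S} \<in> {T \<in> C. T \<subset> S}"
      using fin False chain by (intro Union_in_chain) (auto simp: subset_chain_def)
    then show ?thesis by blast
  qed
  then obtain x where x: "x \<in> S" "\<And>T. T \<in> C \<Longrightarrow> T \<subset> S \<Longrightarrow> x \<notin> T" by blast
  have "{T \<in> C. x \<notin> T} = {T \<in> C. T \<subseteq> S} - {S}"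
    using x chain \<open>S \<in> C\<close> by blast
  moreover have "card ({T \<in> C. T \<subseteq> S} - {S}) + 1 = card {T \<in> C. T \<subseteq> S}"
    using fin \<open>S \<in> C\<close> by (subst card_Suc_Diff1[symmetric, of _ S]) auto
  ultimately show thesis
    using that[OF x(1)] by (simp add: rank_in_def)
qed

text \<open>The absence of isolated vertices keeps the empty set out of the chain of neighbourhoods; an empty
  neighbourhood would leave the first block of the clique empty.\<close>

lemma (in graph) threshold_imp_family_F:
  assumes thr: "threshold G" and "verts G \<noteq> {}" and no_iso: "\<And>v. v \<in> verts G \<Longrightarrow> \<exists>w. v \<rightarrow>\<^bsub>G\<^esub> w"
  shows "G \<in> family_F"
proof -
  obtain K I where KI: "verts G = K \<union> I" "K \<inter> I = {}" "I \<noteq> {}"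
    and clique: "\<And>x y. x \<in> K \<Longrightarrow> y \<in> K \<Longrightarrow> x \<noteq> y \<Longrightarrow> x \<rightarrow>\<^bsub>G\<^esub> y"
    and indep: "\<And>x y. x \<in> I \<Longrightarrow> y \<in> I \<Longrightarrow> \<not> x \<rightarrow>\<^bsub>G\<^esub> y"
    using threshold_split[OF thr assms(2)] by blast
  \<comment> \<open>Levels start at 1, so the level of \<open>x\<close> exceeds by one the number of members avoiding \<open>x\<close>.
    A vertex outside all members gets the extra level \<open>k' + 1\<close>.\<close>
  define C where "C = nbhd G ` I"
  define f where "f x = card {T \<in> C. x \<notin> T} + 1" for x
  define g where "g y = rank_in C (nbhd G y)" for y
  define k' where "k' = card C"
  have fin: "finite C"
    unfolding C_def using KI(1) finite_verts by (metis finite_Un finite_imageI)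
  have C_sub: "S \<subseteq> K" if S: "S \<in> C" for S
  proof
    fix x assume "x \<in> S"
    then obtain y where y: "y \<in> I" "y \<rightarrow>\<^bsub>G\<^esub> x"
      using S unfolding C_def nbhd_def by blast
    then have "x \<notin> I" "x \<in> K \<union> I"
      using indep adj_in_verts(2)[OF y(2)] KI(1) by auto
    then show "x \<in> K" by blast
  qed
  have ne: "{} \<notin> C"
    using no_iso KI(1) unfolding C_def nbhd_def by blast
  have chain: "S \<subseteq> T \<or> T \<subseteq> S" if "S \<in> C" "T \<in> C" for S T
  proof (rule ccontr)
    assume "\<not> (S \<subseteq> T \<or> T \<subseteq> S)"
    then obtain x x' where x: "x \<in> S" "x \<notin> T" "x' \<in> T" "x' \<notin> S" by blast
    obtain y y' where y: "y \<in> I" "S = nbhd G y" "y' \<in> I" "T = nbhd G y'"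
      using \<open>S \<in> C\<close> \<open>T \<in> C\<close> unfolding C_def by blast
    have "x \<in> K" "x' \<in> K" using C_sub x \<open>S \<in> C\<close> \<open>T \<in> C\<close> by blast+
    then have "y \<noteq> x'" "x \<noteq> y'" using y KI(2) by auto
    moreover have "y \<rightarrow>\<^bsub>G\<^esub> x" "y' \<rightarrow>\<^bsub>G\<^esub> x'" "\<not> y \<rightarrow>\<^bsub>G\<^esub> x'" "\<not> y' \<rightarrow>\<^bsub>G\<^esub> x"
      using x y unfolding nbhd_def by auto
    ultimately show False
      using thr unfolding threshold_def by blast
  qed
  have lev: "x \<rightarrow>\<^bsub>G\<^esub> y \<longleftrightarrow> f x \<le> g y" if "x \<in> K" "y \<in> I" for x y
  proof -
    have "x \<rightarrow>\<^bsub>G\<^esub> y \<longleftrightarrow> x \<in> nbhd G y"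
      using dominates_sym by (auto simp: nbhd_def)
    then show ?thesis
      using mem_iff_card_less_rank_in[OF fin chain, of "nbhd G y" x] that
      unfolding f_def g_def C_def by auto
  qed
  have split: "level_split G K I f g"
    unfolding level_split_def using KI clique indep lev adj_not_same by blast
  have gI: "g ` I = {1..k'}"
    using rank_in_chain_image[OF fin chain] unfolding g_def k'_def C_def by (simp add: image_image)
  have "1 \<le> k'"
    using KI(3) fin unfolding k'_def C_def by (simp add: Suc_le_eq card_gt_0_iff)
  have low: "{1..k'} \<subseteq> f ` K"
  proof
    fix i assume "i \<in> {1..k'}"
    then obtain S where S: "S \<in> C" "i = rank_in C S"
      using rank_in_chain_image[OF fin chain] unfolding k'_def by blast
    then obtain x where "x \<in> S" "f x = i"
      using chain_level_attained[OF fin chain ne] unfolding f_def by blast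
    then show "i \<in> f ` K" using C_sub S by blast
  qed
  have "f x \<in> insert (k' + 1) {1..k'}" for x
  proof -
    have "card {T \<in> C. x \<notin> T} \<le> card C"
      using fin by (intro card_mono) auto
    then show ?thesis
      unfolding f_def k'_def by auto
  qed
  then have "f ` K \<subseteq> insert (k' + 1) {1..k'}"
    by blast
  then have "f ` K = {1..k'} \<or> f ` K = insert (k' + 1) {1..k'}"
    using subset_insert[of "k' + 1" "f ` K" "{1..k'}"] low
    by (cases "k' + 1 \<in> f ` K") (simp_all add: subset_antisym)
  then have "f ` K = {1..k'} \<or> f ` K = {1..k' + 1}"
    by (simp add: atLeastAtMostSuc_conv)
  then obtain k where "f ` K = {1..k}" "k' = k \<or> k' = k - 1"
    using that[of k'] that[of "k' + 1"] by (elim disjE) simp_all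
  then have "level_split G K I f g \<and> 1 \<le> k' \<and> (k' = k \<or> k' = k - 1) \<and>
      f ` K = {1..k} \<and> g ` I = {1..k'}"
    using split gI \<open>1 \<le> k'\<close> by (intro conjI)
  then show ?thesis
    unfolding family_F_iff_level_split by (intro exI)
qed

section \<open>The characterization\<close>

lemma (in graph) connected_imp_no_isolated:
  assumes "connected G" "u \<in> verts G" "w \<in> verts G" "u \<noteq> w"
  shows "\<exists>v. u \<rightarrow>\<^bsub>G\<^esub> v"
proof -
  have "u \<rightarrow>\<^sup>*\<^bsub>mk_symmetric G\<^esub> w"
    using assms unfolding connected_def strongly_connected_def by simp
  then have "u \<rightarrow>\<^sup>* w"
    by (simp add: reachable_mk_symmetric_eq[OF sym_arcs])
  then show ?thesis
    using assms(4) by (cases rule: converse_reachable_cases) auto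
qed

theorem theorem5:
  fixes G :: "('a, 'b) pre_digraph" and n :: nat
  assumes "graph G" and "connected G" and "card (verts G) = n"
  shows "super_domination_number G = n - 1 \<longleftrightarrow> G \<in> family_F"
proof -
  interpret graph G by (rule assms(1))
  have ne: "verts G \<noteq> {}"
    using assms(2) unfolding connected_def strongly_connected_def by simp
  show ?thesis
  proof
    assume eq: "super_domination_number G = n - 1"
    \<comment> \<open>For a single vertex the number is 1, since the empty set dominates nothing.\<close>
    have "n \<noteq> 1"
    proof
      assume "n = 1"
      obtain D where "super_dominating G D" "card D = 0"
        using super_domination_number_attained eq \<open>n = 1\<close> by auto
      then have "D = {}"
        unfolding super_dominating_def by (metis card_0_eq finite_subset finite_verts)
      then show False
        using \<open>super_dominating G D\<close> ne unfolding super_dominating_def by blast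
    qed
    have "\<exists>w \<in> verts G. w \<noteq> v" if "v \<in> verts G" for v
    proof (rule ccontr)
      assume "\<not> (\<exists>w \<in> verts G. w \<noteq> v)"
      then have "verts G = {v}" using that by blast
      then show False using \<open>n \<noteq> 1\<close> assms(3) by simp
    qed
    then have no_iso: "\<exists>w. v \<rightarrow>\<^bsub>G\<^esub> w" if "v \<in> verts G" for v
      using connected_imp_no_isolated[OF assms(2)] that by metis
    obtain p q where "p \<rightarrow>\<^bsub>G\<^esub> q"
      using no_iso ne by blast
    then have "threshold G"
      using super_domination_number_eq_pred_iff_threshold eq assms(3) by blast
    then show "G \<in> family_F"
      using threshold_imp_family_F ne no_iso by blast
  next
    assume "G \<in> family_F"
    then obtain K I f g k k' where L: "level_split G K I f g" and k: "1 \<le> k'" "k' = k \<or> k' = k - 1"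
      and fK: "f ` K = {1..k}" and gI: "g ` I = {1..k'}"
      unfolding family_F_iff_level_split by (elim exE conjE)
    \<comment> \<open>Both lowest blocks are inhabited, which provides an edge.\<close>
    have "1 \<in> f ` K" "1 \<in> g ` I"
      using k fK gI by auto
    then obtain x y where "x \<in> K" "f x = 1" "y \<in> I" "g y = 1"
      by (metis imageE)
    then have "x \<rightarrow>\<^bsub>G\<^esub> y"
      using L unfolding level_split_def by simp
    then show "super_domination_number G = n - 1"
      using super_domination_number_eq_pred_iff_threshold level_split_imp_threshold[OF L] assms(3)
      by simp
  qed
qed

end
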